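(* There exist infinitely many (pairwise non-isomorphic) cubic $2$-connected graphs $G$ which contain at least two Šoltés vertices.
   Context: All graphs are finite, simple and undirected. For a connected graph $G$, the Wiener index is $W(G)=\sum_{\{u,v\}\subseteq V(G)} d_G(u,v)$, where $d_G(u,v)$ is the length of a shortest $u$–$v$ path; if $G$ is disconnected, $W(G)=\infty$. For $v\in V(G)$, $G-v$ denotes the graph obtained by deleting $v$ (and its incident edges). A vertex $v$ of $G$ is a Šoltés vertex of $G$ if $W(G-v)=W(G)$. *)

theory Defs
  imports
    "Graph_Theory.Pair_Digraph"
    "Graph_Theory.Digraph_Isomorphism"
    "Graph_Theory.Shortest_Path"
    "HOL-Library.Extended_Nat"
begin

text \<open>
  Finite simple undirected graphs are the library's \<^locale>\<open>pair_graph\<close>s: finite, loopfree digraphs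
  without parallel arcs whose arc relation is symmetric, an edge $uv$ being the two arcs
  $(u,v)$ and $(v,u)$.  The notions below are stated for \<^typ>\<open>('a, 'b) pre_digraph\<close>, into which
  pair graphs are embedded by the coercion \<^const>\<open>with_proj\<close>, and are meant for symmetric digraphs.
\<close>

text \<open>Only meaningful if there is a path from \<open>u\<close> to \<open>v\<close>.\<close>

definition graph_dist :: "('a, 'b) pre_digraph \<Rightarrow> 'a \<Rightarrow> 'a \<Rightarrow> nat" where
  "graph_dist G u v = (LEAST n. \<exists>p. pre_digraph.apath G u p v \<and> length p = n)"

text \<open>The linear order on the vertices only serves to list every unordered pair once.\<close>

definition wiener_index :: "('a::linorder, 'b) pre_digraph \<Rightarrow> enat" where
  "wiener_index G =
    (if Digraph_Component.connected G
     then enat (\<Sum>(u, v) | u \<in> verts G \<and> v \<in> verts G \<and> u < v. graph_dist G u v)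
     else \<infinity>)"

definition soltes_vertex :: "('a::linorder, 'b) pre_digraph \<Rightarrow> 'a \<Rightarrow> bool" where
  "soltes_vertex G v \<longleftrightarrow>
    v \<in> verts G \<and> wiener_index (pre_digraph.del_vert G v) = wiener_index G"

text \<open>In a simple symmetric digraph the out-degree is the degree of the undirected graph.\<close>

definition cubic :: "('a, 'b) pre_digraph \<Rightarrow> bool" where
  "cubic G \<longleftrightarrow> (\<forall>v \<in> verts G. out_degree G v = 3)"

definition two_connected :: "('a, 'b) pre_digraph \<Rightarrow> bool" where
  "two_connected G \<longleftrightarrow>
    card (verts G) > 2 \<and> Digraph_Component.connected G \<and>
    (\<forall>v \<in> verts G. Digraph_Component.connected (pre_digraph.del_vert G v))"

text \<open>On reachable pairs, \<^const>\<open>graph_dist\<close> is the library's weighted distance for unit weights.\<close>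

lemma (in fin_digraph) graph_dist_eq_mu:
  assumes "u \<rightarrow>\<^sup>* v"
  shows "ereal (real (graph_dist G u v)) = \<mu> (\<lambda>_. 1) u v"
proof -
  have cost: "awalk_cost (\<lambda>_. 1) p = real (length p)" for p
    by (induction p) auto
  obtain p where p: "apath u p v" and mu: "\<mu> (\<lambda>_. 1) u v = awalk_cost (\<lambda>_. 1) p"
    using min_cost_awalk[OF assms, of "\<lambda>_. 1"] by auto
  have "graph_dist G u v = length p"
    unfolding graph_dist_def
  proof (rule Least_equality)
    show "\<exists>q. apath u q v \<and> length q = length p" using p by blast
  next
    fix n assume "\<exists>q. apath u q v \<and> length q = n"
    then obtain q where "awalk u q v" "length q = n" by (auto simp: apath_def)
    then show "length p \<le> n"
      using min_cost_le_walk_cost[of u q v "\<lambda>_. 1"] mu by (simp add: cost)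
  qed
  then show ?thesis using mu by (simp add: cost)
qed

end

theory Submission
  imports Defs
begin

text \<open>
  Take two copies of a graph \<open>H\<close> whose vertices have degree 2 or 3, and join the two copies of each
  vertex of degree 2 by a rung; the result is cubic.  If \<open>c\<close> is a cut vertex of \<open>H\<close> of degree 3 and
  one copy of \<open>c\<close> is deleted, the only distances that change are those, within that copy of \<open>H\<close>,
  between different components of \<open>H - c\<close>: such paths now have to pass through the other copy, which
  costs two additional rungs.  So \<open>c\<close> is a Soltes vertex (and so is its twin) iff twice the number of
  these pairs is the sum of the distances from \<open>c\<close> in the doubled graph.

  We let \<open>H - c\<close> consist of three paths, each with its last three vertices completed to a triangle.
  If the paths have \<open>x\<close>, \<open>y\<close> and \<open>z\<close> vertices, the condition becomes
  \<open>2 (x y + x z + y z) = x (x + 2) + y (y + 2) + z (z + 2) - 3\<close>; for \<open>z = 4\<close> it reads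
  \<open>(x - y)\<^sup>2 + 21 = 6 (x + y)\<close>, which is solved by \<open>x = 3 s\<^sup>2 + 6 s + 4\<close> and \<open>y = 3 s\<^sup>2 + 1\<close>.
\<close>

section \<open>Graphs given by an adjacency relation\<close>

text \<open>Coding by \<open>to_nat\<close> supplies the linear order that
  \<open>wiener_index\<close> asks for, while the constructions can use pairs as vertices. Since
  \<open>E\<close> is cut down to \<open>V\<close>, deleting a vertex only shrinks
  \<open>V\<close>.\<close>

definition nat_graph :: "'a::countable set \<Rightarrow> ('a \<Rightarrow> 'a \<Rightarrow> bool) \<Rightarrow> nat pair_pre_digraph" where
  "nat_graph V E = \<lparr>pverts = to_nat ` V, parcs = {(to_nat x, to_nat y) |x y. x \<in> V \<and> y \<in> V \<and> E x y}\<rparr>"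

lemma pverts_nat_graph [simp]: "pverts (nat_graph V E) = to_nat ` V"
  by (simp add: nat_graph_def)

lemma parcs_nat_graph [simp]:
  "(to_nat x, to_nat y) \<in> parcs (nat_graph V E) \<longleftrightarrow> x \<in> V \<and> y \<in> V \<and> E x y"
  by (auto simp: nat_graph_def)

lemma parcs_nat_graphE:
  assumes "e \<in> parcs (nat_graph V E)"
  obtains x y where "e = (to_nat x, to_nat y)" "x \<in> V" "y \<in> V" "E x y"
  using assms by (auto simp: nat_graph_def)

lemma pair_wf_nat_graph: "pair_wf_digraph (nat_graph V E)"
  by unfold_locales (auto elim!: parcs_nat_graphE)

lemma del_vert_nat_graph:
  "pre_digraph.del_vert (with_proj (nat_graph V E)) (to_nat v) = with_proj (nat_graph (V - {v}) E)"
  unfolding pre_digraph.del_vert_def with_proj_def nat_graph_def by auto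

lemma card_pverts_nat_graph: "card (pverts (nat_graph V E)) = card V"
  by (simp add: card_image inj_on_def)

lemma out_degree_nat_graph:
  assumes "x \<in> V"
  shows "out_degree (with_proj (nat_graph V E)) (to_nat x) = card {y \<in> V. E x y}"
proof -
  have "out_arcs (with_proj (nat_graph V E)) (to_nat x) = (\<lambda>y. (to_nat x, to_nat y)) ` {y \<in> V. E x y}"
    using assms by (auto simp: out_arcs_def elim!: parcs_nat_graphE)
  then show ?thesis
    by (simp add: out_degree_def card_image inj_on_def)
qed

locale fin_sym_rel =
  fixes V :: "'a::countable set" and E :: "'a \<Rightarrow> 'a \<Rightarrow> bool"
  assumes finite_V: "finite V"
    and E_sym: "E x y \<Longrightarrow> E y x"
    and E_irrefl: "\<not> E x x"
begin

lemma pair_graph_nat_graph: "pair_graph (nat_graph V E)"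
proof -
  interpret pair_wf_digraph "nat_graph V E" by (rule pair_wf_nat_graph)
  have "parcs (nat_graph V E) \<subseteq> to_nat ` V \<times> to_nat ` V"
    by (auto simp: nat_graph_def)
  then have "finite (parcs (nat_graph V E))"
    by (rule finite_subset) (simp add: finite_V)
  moreover have "sym (parcs (nat_graph V E))"
    by (auto simp: sym_def nat_graph_def E_sym)
  ultimately show ?thesis
    using finite_V E_irrefl
    by unfold_locales (auto simp: symmetric_def elim!: parcs_nat_graphE)
qed

sublocale nat_graph: pair_graph "nat_graph V E"
  by (rule pair_graph_nat_graph)

lemma reachable_nat_graph:
  assumes "(x, y) \<in> {(x, y). x \<in> V \<and> y \<in> V \<and> E x y}\<^sup>*" "x \<in> V"
  shows "to_nat x \<rightarrow>\<^sup>*\<^bsub>with_proj (nat_graph V E)\<^esub> to_nat y"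
  using assms
proof (induction rule: rtrancl_induct)
  case base
  then show ?case by (intro nat_graph.reachable_refl) simp
next
  case (step y z)
  then show ?case
    by (auto intro: nat_graph.reachable_adj_trans)
qed

lemma connected_nat_graphI:
  assumes "u \<in> V"
    and "\<And>x. x \<in> V \<Longrightarrow> (x, u) \<in> {(x, y). x \<in> V \<and> y \<in> V \<and> E x y}\<^sup>*"
  shows "Digraph_Component.connected (with_proj (nat_graph V E))"
proof -
  let ?R = "{(x, y). x \<in> V \<and> y \<in> V \<and> E x y}"
  have "sym (?R\<^sup>*)"
    by (intro sym_rtrancl) (auto simp: sym_def E_sym)
  then have "(x, y) \<in> ?R\<^sup>*" if "x \<in> V" "y \<in> V" for x y
    using assms(2)[OF that(1)] assms(2)[OF that(2)] by (meson rtrancl_trans symE)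
  then have "to_nat x \<rightarrow>\<^sup>*\<^bsub>with_proj (nat_graph V E)\<^esub> to_nat y" if "x \<in> V" "y \<in> V" for x y
    using that by (intro reachable_nat_graph)
  then show ?thesis
    using assms(1) unfolding connected_conv reachable_def
    by (auto intro: rtrancl_on_mono[rotated 2] simp: symcl_def)
qed

end

section \<open>Distance functions certified by local conditions\<close>

locale rel_distance = fin_sym_rel +
  fixes D :: "'a \<Rightarrow> 'a \<Rightarrow> nat"
  assumes D_refl: "u \<in> V \<Longrightarrow> D u u = 0"
    and D_sym: "D u x = D x u"
    and D_step: "u \<in> V \<Longrightarrow> x \<in> V \<Longrightarrow> y \<in> V \<Longrightarrow> E x y \<Longrightarrow> D u y \<le> D u x + 1"
    and D_descent: "u \<in> V \<Longrightarrow> x \<in> V \<Longrightarrow> x \<noteq> u \<Longrightarrow> \<exists>y\<in>V. E x y \<and> D u y < D u x"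
begin

text \<open>Following \<open>D_descent\<close> lowers \<open>D u\<close> by at least 1 per arc, so
  \<open>u\<close> is reached after at most \<open>D u x\<close> arcs.\<close>

lemma exists_awalk:
  assumes "u \<in> V" "x \<in> V"
  shows "\<exists>p. nat_graph.awalk (to_nat x) p (to_nat u) \<and> length p \<le> D u x"
  using assms(2)
proof (induction "D u x" arbitrary: x rule: less_induct)
  case less
  show ?case
  proof (cases "x = u")
    case True
    then show ?thesis
      using less.prems by (intro exI[of _ "[]"]) (auto simp: nat_graph.awalk_Nil_iff)
  next
    case False
    then obtain y where y: "y \<in> V" "E x y" "D u y < D u x"
      using D_descent[OF assms(1) less.prems] by auto
    obtain p where "nat_graph.awalk (to_nat y) p (to_nat u)" "length p \<le> D u y"
      using less.hyps[OF y(3) y(1)] by auto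
    then show ?thesis
      using y less.prems
      by (intro exI[of _ "(to_nat x, to_nat y) # p"]) (auto simp: nat_graph.awalk_Cons_iff)
  qed
qed

text \<open>Along an arc \<open>D u\<close> changes by at most 1, and it vanishes at
  \<open>u\<close>. With \<open>exists_awalk\<close> this identifies \<open>D\<close> as the
  distance.\<close>

lemma distance_le_length:
  assumes "u \<in> V" "x \<in> V" "nat_graph.awalk (to_nat x) p (to_nat u)"
  shows "D u x \<le> length p"
  using assms(2,3)
proof (induction p arbitrary: x)
  case Nil
  then show ?case using assms(1) by (auto simp: nat_graph.awalk_Nil_iff D_refl)
next
  case (Cons e p)
  then obtain y where y: "y \<in> V" "E x y" "nat_graph.awalk (to_nat y) p (to_nat u)"
    by (auto simp: nat_graph.awalk_Cons_iff elim!: parcs_nat_graphE)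
  then have "D u x \<le> D u y + 1"
    using D_step[OF assms(1) y(1) Cons.prems(1)] E_sym by auto
  then show ?case using Cons.IH[OF y(1,3)] by simp
qed

lemma graph_dist_nat_graph:
  assumes "u \<in> V" "x \<in> V"
  shows "graph_dist (with_proj (nat_graph V E)) (to_nat x) (to_nat u) = D x u"
proof -
  let ?G = "with_proj (nat_graph V E)"
  obtain p where p: "nat_graph.awalk (to_nat x) p (to_nat u)" "length p \<le> D u x"
    using exists_awalk[OF assms] by auto
  then have reach: "to_nat x \<rightarrow>\<^sup>*\<^bsub>?G\<^esub> to_nat u"
    by (auto intro: nat_graph.reachable_awalkI)
  have cost: "nat_graph.awalk_cost (\<lambda>_. 1) q = real (length q)" for q
    by (induction q) auto
  have "ereal (graph_dist ?G (to_nat x) (to_nat u)) \<le> ereal (length p)"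
    using nat_graph.graph_dist_eq_mu[OF reach]
      nat_graph.min_cost_le_walk_cost[OF p(1), of "\<lambda>_. 1"] by (simp add: cost)
  moreover have ex: "\<exists>n q. nat_graph.apath (to_nat x) q (to_nat u) \<and> length q = n"
    using reach by (simp add: nat_graph.reachable_apath)
  then obtain q where "nat_graph.apath (to_nat x) q (to_nat u)"
      "length q = graph_dist ?G (to_nat x) (to_nat u)"
    unfolding graph_dist_def using LeastI_ex[OF ex] by blast
  then have "D u x \<le> graph_dist ?G (to_nat x) (to_nat u)"
    using distance_le_length[OF assms] nat_graph.awalkI_apath by metis
  ultimately show ?thesis using p(2) D_sym[of u x] by simp
qed

lemma connected_nat_graph:
  assumes "V \<noteq> {}"
  shows "Digraph_Component.connected (with_proj (nat_graph V E))"
proof -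
  obtain u where u: "u \<in> V" using assms by auto
  show ?thesis
  proof (rule connected_nat_graphI[OF u])
    fix x assume "x \<in> V"
    then show "(x, u) \<in> {(x, y). x \<in> V \<and> y \<in> V \<and> E x y}\<^sup>*"
    proof (induction "D u x" arbitrary: x rule: less_induct)
      case less
      show ?case
      proof (cases "x = u")
        case False
        then obtain y where "y \<in> V" "E x y" "D u y < D u x"
          using D_descent[OF u less.prems] by auto
        with less show ?thesis
          by (intro converse_rtrancl_into_rtrancl[of x y]) auto
      qed simp
    qed
  qed
qed

text \<open>Summing over ordered pairs removes the order on the vertices: the two strict halves
  agree by symmetry and the diagonal is 0. Stating the double of \<open>w\<close> avoids a
  division.\<close>

lemma wiener_index_nat_graph:
  assumes "V \<noteq> {}"
  obtains w where "wiener_index (with_proj (nat_graph V E)) = enat w"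
    and "2 * w = (\<Sum>x\<in>V. \<Sum>y\<in>V. D x y)"
proof -
  let ?d = "graph_dist (with_proj (nat_graph V E))"
  let ?U = "to_nat ` V" and ?P = "{(u, v). u \<in> to_nat ` V \<and> v \<in> to_nat ` V \<and> u < v}"
  have fin: "finite (?U \<times> ?U)" using finite_V by simp
  have U: "?U \<times> ?U = ?P \<union> ?P\<inverse> \<union> Id_on ?U" by (auto simp: not_less_iff_gr_or_eq Id_on_def)
  have finP: "finite ?P" "finite (?P\<inverse>)" "finite (Id_on ?U)" using fin by (auto simp: U)
  have "(\<Sum>x\<in>V. \<Sum>y\<in>V. D x y) = (\<Sum>x\<in>V. \<Sum>y\<in>V. ?d (to_nat x) (to_nat y))"
    by (intro sum.cong refl) (simp add: graph_dist_nat_graph)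
  also have "\<dots> = (\<Sum>u\<in>?U. \<Sum>v\<in>?U. ?d u v)"
    by (simp add: sum.reindex inj_on_def)
  also have "\<dots> = (\<Sum>(u, v)\<in>?U \<times> ?U. ?d u v)"
    by (simp add: sum.cartesian_product)
  also have "\<dots> = (\<Sum>(u, v)\<in>?P. ?d u v) + (\<Sum>(u, v)\<in>?P\<inverse>. ?d u v) + (\<Sum>(u, v)\<in>Id_on ?U. ?d u v)"
    unfolding U using finP by (subst sum.union_disjoint; (subst sum.union_disjoint)?) auto
  also have "(\<Sum>(u, v)\<in>Id_on ?U. ?d u v) = 0"
    by (intro sum.neutral) (auto simp: graph_dist_nat_graph D_refl)
  also have "(\<Sum>(u, v)\<in>?P\<inverse>. ?d u v) = (\<Sum>(u, v)\<in>?P. ?d u v)"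
    by (rule sum.reindex_bij_witness[where i = prod.swap and j = prod.swap])
      (auto simp: graph_dist_nat_graph D_sym)
  finally have "2 * (\<Sum>(u, v)\<in>?P. ?d u v) = (\<Sum>x\<in>V. \<Sum>y\<in>V. D x y)" by simp
  moreover have "wiener_index (with_proj (nat_graph V E)) = enat (\<Sum>(u, v)\<in>?P. ?d u v)"
    using connected_nat_graph[OF assms] by (simp add: wiener_index_def)
  ultimately show ?thesis using that by blast
qed

end

text \<open>Deleting \<open>v\<close> removes a row and a column from the double sum, equal by
  symmetry; by \<open>incr\<close> the growth of the remaining distances makes up for both.\<close>

lemma soltes_vertex_nat_graphI:
  assumes "rel_distance V E D" "rel_distance (V - {v}) E D'" "v \<in> V" "V \<noteq> {v}"
    and incr: "(\<Sum>x\<in>V - {v}. \<Sum>y\<in>V - {v}. D' x y) =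
      (\<Sum>x\<in>V - {v}. \<Sum>y\<in>V - {v}. D x y) + 2 * (\<Sum>y\<in>V - {v}. D v y)"
  shows "soltes_vertex (with_proj (nat_graph V E)) (to_nat v)"
proof -
  interpret G: rel_distance V E D by fact
  interpret G': rel_distance "V - {v}" E D' by fact
  obtain w where w: "wiener_index (with_proj (nat_graph V E)) = enat w"
      "2 * w = (\<Sum>x\<in>V. \<Sum>y\<in>V. D x y)"
    using G.wiener_index_nat_graph assms(3) by auto
  obtain w' where w': "wiener_index (with_proj (nat_graph (V - {v}) E)) = enat w'"
      "2 * w' = (\<Sum>x\<in>V - {v}. \<Sum>y\<in>V - {v}. D' x y)"
    using G'.wiener_index_nat_graph assms(3,4) by auto
  have split: "(\<Sum>y\<in>V. f y) = f v + (\<Sum>y\<in>V - {v}. f y)" for f :: "'a \<Rightarrow> nat"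
    using G.finite_V assms(3) by (rule sum.remove)
  have "(\<Sum>x\<in>V. \<Sum>y\<in>V. D x y) = (\<Sum>x\<in>V - {v}. \<Sum>y\<in>V - {v}. D x y) + 2 * (\<Sum>y\<in>V - {v}. D v y)"
  proof -
    have "(\<Sum>x\<in>V - {v}. D x v) = (\<Sum>x\<in>V - {v}. D v x)"
      by (intro sum.cong refl G.D_sym)
    then show ?thesis
      unfolding split sum.distrib using G.D_refl[OF assms(3)] by simp
  qed
  with w w' incr have "w' = w" by linarith
  with w w' assms(3) show ?thesis
    by (simp add: soltes_vertex_def del_vert_nat_graph)
qed

lemma digraph_iso_card_verts:
  assumes "digraph_iso G H"
  shows "card (verts G) = card (verts H)"
proof -
  obtain hom where "pre_digraph.digraph_isomorphism G hom" "H = app_iso hom G"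
    using assms by (auto simp: digraph_iso_def)
  then show ?thesis
    by (simp add: pre_digraph.digraph_isomorphism_def card_image)
qed

section \<open>Doubling a graph\<close>

text \<open>\<open>R\<close> holds the vertices of degree 2, which get rungs. By
  \<open>rung_cover\<close> every neighbour of a vertex without a rung has one. \<open>arm\<close>
  labels the parts of \<open>H - c\<close>: arcs avoiding \<open>c\<close> stay in one part, and by
  \<open>arm_descent\<close> two vertices of one part have a shortest path that avoids
  \<open>c\<close>.\<close>

locale rung_double = rel_distance H A d
  for H :: "'a::countable set" and A :: "'a \<Rightarrow> 'a \<Rightarrow> bool" and d :: "'a \<Rightarrow> 'a \<Rightarrow> nat" +
  fixes R :: "'a set" and c :: 'a and arm :: "'a \<Rightarrow> nat"
  assumes c_in_H: "c \<in> H" and c_notin_R: "c \<notin> R"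
    and rung_cover: "A p q \<Longrightarrow> p \<in> R \<or> q \<in> R"
    and degree: "p \<in> H \<Longrightarrow> card {q \<in> H. A p q} = (if p \<in> R then 2 else 3)"
    and arm_adj: "p \<in> H - {c} \<Longrightarrow> q \<in> H - {c} \<Longrightarrow> A p q \<Longrightarrow> arm p = arm q"
    and arm_descent: "p \<in> H - {c} \<Longrightarrow> q \<in> H - {c} \<Longrightarrow> arm p = arm q \<Longrightarrow> p \<noteq> q \<Longrightarrow>
      \<exists>y\<in>H - {c}. A q y \<and> d p y < d p q"
begin

definition verts2 :: "(bool \<times> 'a) set" where
  "verts2 = UNIV \<times> H"

fun adj2 :: "bool \<times> 'a \<Rightarrow> bool \<times> 'a \<Rightarrow> bool" where
  "adj2 (s, p) (t, q) \<longleftrightarrow> (if s = t then A p q else p = q \<and> p \<in> R)"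

text \<open>Changing copies costs one rung, available somewhere on a shortest path of
  \<open>H\<close> by \<open>rung_cover\<close>. The exception is a pair of twins without a rung:
  the path must visit a neighbour, cross and return, hence 3.\<close>

fun dist2 :: "bool \<times> 'a \<Rightarrow> bool \<times> 'a \<Rightarrow> nat" where
  "dist2 (s, p) (t, q) = (if s = t then d p q else if p = q \<and> p \<notin> R then 3 else d p q + 1)"

text \<open>The extra length caused by deleting \<open>(b, c)\<close>: between different arms of
  copy \<open>b\<close> a path must cross over and back. If an end lies in the other copy, the path
  can pass through the centre there.\<close>

fun detour :: "bool \<Rightarrow> bool \<times> 'a \<Rightarrow> bool \<times> 'a \<Rightarrow> nat" where
  "detour b (s, p) (t, q) = (if s = b \<and> t = b \<and> arm p \<noteq> arm q then 2 else 0)"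

abbreviation graph2 :: "nat pair_pre_digraph" where
  "graph2 \<equiv> nat_graph verts2 adj2"

lemma d_pos:
  assumes "p \<in> H" "q \<in> H" "p \<noteq> q"
  shows "0 < d p q"
  using D_descent[of p q] assms by auto

text \<open>Degree 3 leaves a neighbour other than \<open>p\<close>; by \<open>rung_cover\<close> it
  has a rung, so it is not \<open>c\<close>.\<close>

lemma neighbour_ne:
  assumes "q \<in> H" "q \<notin> R"
  shows "\<exists>y\<in>H. y \<noteq> p \<and> y \<in> R \<and> y \<noteq> c \<and> A q y"
proof -
  have "\<not> {y \<in> H. A q y} \<subseteq> {p}"
  proof
    assume "{y \<in> H. A q y} \<subseteq> {p}"
    then have "card {y \<in> H. A q y} \<le> card {p}" by (intro card_mono) auto
    then show False using degree assms by simp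
  qed
  then obtain y where "y \<in> H" "A q y" "y \<noteq> p" by auto
  then show ?thesis using rung_cover[of q y] assms c_notin_R by auto
qed

lemma fin_sym_rel_adj2: "fin_sym_rel W adj2" if "W \<subseteq> verts2"
proof
  show "finite W"
    using that finite_V by (auto simp: verts2_def intro: finite_subset)
next
  fix x y assume "adj2 x y"
  then show "adj2 y x" by (cases x; cases y) (auto intro: E_sym split: if_splits)
next
  fix x show "\<not> adj2 x x" by (cases x) (simp add: E_irrefl)
qed

lemma descent2:
  assumes "p \<in> H" "q \<in> H" "(t, q) \<noteq> (s, p)"
  shows "\<exists>y\<in>verts2. adj2 (t, q) y \<and> dist2 (s, p) y < dist2 (s, p) (t, q)"
proof -
  consider "s = t" | "s \<noteq> t" "q \<in> R" | "s \<noteq> t" "q \<notin> R" "p = q" | "s \<noteq> t" "q \<notin> R" "p \<noteq> q"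
    by blast
  then show ?thesis
  proof cases
    case 1
    then obtain y where "y \<in> H" "A q y" "d p y < d p q"
      using D_descent[of p q] assms by auto
    then show ?thesis using 1 by (intro bexI[of _ "(t, y)"]) (auto simp: verts2_def)
  next
    case 2
    then show ?thesis using assms by (intro bexI[of _ "(s, q)"]) (auto simp: verts2_def)
  next
    case 3
    \<comment> \<open>The first step of the path of length 3 between twins: \<open>y\<close> is a
      neighbour other than \<open>p\<close>, so its distance is at most 2.\<close>
    obtain y where "y \<in> H" "y \<noteq> p" "A q y"
      using neighbour_ne[of q p] 3 assms by auto
    moreover have "d p y \<le> d p q + 1"
      using D_step[of p q y] assms calculation by auto
    ultimately show ?thesis
      using 3 D_refl[OF assms(1)] by (intro bexI[of _ "(t, y)"]) (auto simp: verts2_def)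
  next
    case 4
    then obtain y where "y \<in> H" "A q y" "d p y < d p q"
      using D_descent[of p q] assms by auto
    \<comment> \<open>If \<open>y\<close> is \<open>p\<close> itself, \<open>rung_cover\<close>
      gives \<open>p\<close> a rung, so the exceptional value 3 does not arise.\<close>
    then show ?thesis
      using 4 rung_cover[of q y] by (intro bexI[of _ "(t, y)"]) (auto simp: verts2_def)
  qed
qed

lemma step2:
  assumes "u \<in> verts2" "x \<in> verts2" "y \<in> verts2" "adj2 x y"
  shows "dist2 u y \<le> dist2 u x + 1"
proof -
  obtain r p s q t q' where eqs: "u = (r, p)" "x = (s, q)" "y = (t, q')"
    by (metis prod.exhaust)
  with assms have H: "p \<in> H" "q \<in> H" "q' \<in> H" by (auto simp: verts2_def)
  show ?thesis
  proof (cases "s = t")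
    case True
    with assms eqs have "A q q'" by simp
    moreover have "d p q' \<le> d p q + 1" using D_step H \<open>A q q'\<close> by blast
    \<comment> \<open>Needed when the arc enters the twin of \<open>p\<close>, possibly at distance
      3: its start is then at distance \<open>d p q + 1\<close>, which is at least 2.\<close>
    moreover have "p \<noteq> q \<Longrightarrow> 0 < d p q" using d_pos H by blast
    moreover have "q' \<noteq> q" using \<open>A q q'\<close> E_irrefl by blast
    ultimately show ?thesis
      using True eqs D_refl H E_irrefl by auto
  next
    case False
    with assms eqs show ?thesis by auto
  qed
qed

lemma rel_distance_dist2: "rel_distance verts2 adj2 dist2"
proof -
  interpret G: fin_sym_rel verts2 adj2 by (rule fin_sym_rel_adj2) simp
  show ?thesis
  proof
    show "dist2 u u = 0" if "u \<in> verts2" for u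
      using that D_refl by (cases u) (auto simp: verts2_def)
    show "dist2 u x = dist2 x u" for u x
      by (cases u; cases x) (auto simp: D_sym)
    show "dist2 u y \<le> dist2 u x + 1" if "u \<in> verts2" "x \<in> verts2" "y \<in> verts2" "adj2 x y" for u x y
      using step2 that by blast
    show "\<exists>y\<in>verts2. adj2 x y \<and> dist2 u y < dist2 u x" if "u \<in> verts2" "x \<in> verts2" "x \<noteq> u" for u x
      using descent2 that by (cases u; cases x) (auto simp: verts2_def)
  qed
qed

section \<open>Distances after deleting one copy of the centre\<close>

lemma detour_step:
  assumes "u \<in> verts2 - {(b, c)}" "x \<in> verts2 - {(b, c)}" "y \<in> verts2 - {(b, c)}" "adj2 x y"
  shows "dist2 u y + detour b u y \<le> dist2 u x + detour b u x + 1"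
proof -
  obtain r p s q t q' where eqs: "u = (r, p)" "x = (s, q)" "y = (t, q')"
    by (metis prod.exhaust)
  show ?thesis
  proof (cases "s = t")
    case True
    then have "detour b u y = detour b u x"
      using assms arm_adj[of q q'] by (auto simp: eqs verts2_def)
    then show ?thesis using step2[of u x y] assms by simp
  next
    case False
    \<comment> \<open>Entering copy \<open>b\<close> along a rung in another arm than that of
      \<open>u\<close> saves 1 in \<open>dist2\<close> but adds a detour of 2, a net increase of
      1.\<close>
    with assms show ?thesis
      by (auto simp: eqs)
  qed
qed

text \<open>The cases trace a shortest path from \<open>x\<close> back to \<open>u\<close>. In copy
  \<open>b\<close> it stays in the arm of \<open>u\<close>, leaves by a rung, or first moves to a
  vertex with a rung; from the intact copy it enters copy \<open>b\<close> only in the arm of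
  \<open>u\<close>.\<close>

lemma detour_descent:
  assumes "u \<in> verts2 - {(b, c)}" "x \<in> verts2 - {(b, c)}" "x \<noteq> u"
  shows "\<exists>y\<in>verts2 - {(b, c)}. adj2 x y \<and> dist2 u y + detour b u y < dist2 u x + detour b u x"
proof -
  obtain s p t q where eqs: "u = (s, p)" "x = (t, q)"
    by (metis prod.exhaust)
  have H: "p \<in> H" "q \<in> H" using assms eqs by (auto simp: verts2_def)
  consider (same) "s = t" "s = b" "arm p = arm q"
    | (cross_over) "s = t" "s = b" "arm p \<noteq> arm q" "q \<in> R"
    | (branch) "t = b" "q \<notin> R" "s = b \<longrightarrow> arm p \<noteq> arm q"
    | (uncross) "s \<noteq> b" "t = b" "q \<in> R"
    | (along) "t \<noteq> b" "s = b" "q \<in> R" "arm p \<noteq> arm q"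
    | (intact) "t \<noteq> b" "s = b \<longrightarrow> q \<in> R \<longrightarrow> arm p = arm q"
    by blast
  then show ?thesis
  proof cases
    case same
    then obtain y where "y \<in> H - {c}" "A q y" "d p y < d p q"
      using arm_descent[of p q] assms by (auto simp: eqs verts2_def)
    moreover then have "arm y = arm q"
      using arm_adj[of q y] assms same by (auto simp: eqs verts2_def)
    ultimately show ?thesis
      using same by (intro bexI[of _ "(t, y)"]) (auto simp: eqs verts2_def)
  next
    case cross_over
    then show ?thesis
      using H by (intro bexI[of _ "(\<not> t, q)"]) (auto simp: eqs verts2_def)
  next
    case branch
    obtain y where y: "y \<in> verts2" "adj2 x y" "dist2 u y < dist2 u x"
      using descent2[of p q t s] assms H by (auto simp: eqs)
    obtain q' where q': "y = (t, q')" "A q q'" "q' \<in> H"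
      using y(1,2) branch by (cases y) (auto simp: eqs verts2_def split: if_splits)
    \<comment> \<open>As \<open>q\<close> has no rung, its neighbour has one, whereas
      \<open>c\<close> has none: the step cannot hit the deleted vertex.\<close>
    with branch have "q' \<noteq> c" using rung_cover[of q q'] c_notin_R by auto
    moreover then have "arm q = arm q'"
      using arm_adj[of q q'] q' assms branch by (auto simp: eqs verts2_def)
    then have "detour b u y = detour b u x"
      by (simp add: eqs q')
    ultimately show ?thesis using y q' by (intro bexI[of _ y]) auto
  next
    case uncross
    then show ?thesis
      using H by (intro bexI[of _ "(s, q)"]) (auto simp: eqs verts2_def)
  next
    case along
    \<comment> \<open>Crossing here would enter copy \<open>b\<close> in the wrong arm, so the path
      continues inside the intact copy.\<close>
    then obtain y where y: "y \<in> H" "A q y" "d p y < d p q"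
      using D_descent[of p q] H by auto
    \<comment> \<open>In fact \<open>y = p\<close> is impossible: the arc would avoid
      \<open>c\<close> and force equal arms. So the value 3 does not occur.\<close>
    then have "y = p \<longrightarrow> p \<in> R"
      using arm_adj[of q p] assms along c_notin_R by (auto simp: eqs verts2_def)
    then show ?thesis
      using y along by (intro bexI[of _ "(t, y)"]) (auto simp: eqs verts2_def)
  next
    case intact
    obtain y where y: "y \<in> verts2" "adj2 x y" "dist2 u y < dist2 u x"
      using descent2[of p q t s] assms H by (auto simp: eqs)
    moreover have "detour b u y = 0"
      using y(2) intact by (cases y) (auto simp: eqs split: if_splits)
    moreover have "y \<noteq> (b, c)"
      using y(2) intact c_notin_R by (auto simp: eqs split: if_splits)
    ultimately show ?thesis by (intro bexI[of _ y]) auto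
  qed
qed

lemma rel_distance_del_centre:
  "rel_distance (verts2 - {(b, c)}) adj2 (\<lambda>x y. dist2 x y + detour b x y)"
proof -
  interpret G: rel_distance verts2 adj2 dist2 by (rule rel_distance_dist2)
  interpret G': fin_sym_rel "verts2 - {(b, c)}" adj2 by (rule fin_sym_rel_adj2) simp
  show ?thesis
  proof
    show "dist2 u u + detour b u u = 0" if "u \<in> verts2 - {(b, c)}" for u
      using that G.D_refl[of u] by (cases u) auto
    show "dist2 u x + detour b u x = dist2 x u + detour b x u" for u x
      using G.D_sym[of u x] by (cases u; cases x) auto
  qed (use detour_step detour_descent in blast)+
qed

section \<open>Cubicity and 2-connectedness of the doubled graph\<close>

lemma connected_del_vert:
  assumes "x \<in> verts2"
  shows "Digraph_Component.connected (with_proj (nat_graph (verts2 - {x}) adj2))"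
proof -
  interpret G': fin_sym_rel "verts2 - {x}" adj2 by (rule fin_sym_rel_adj2) simp
  obtain b p where x: "x = (b, p)" by (cases x)
  let ?E = "{(v, w). v \<in> verts2 - {x} \<and> w \<in> verts2 - {x} \<and> adj2 v w}"
  \<comment> \<open>The copy without the deleted vertex stays connected, and everything else is
    linked to it.\<close>
  have intact: "((\<not> b, q), (\<not> b, c)) \<in> ?E\<^sup>*" if "q \<in> H" for q
    using that
  proof (induction "d c q" arbitrary: q rule: less_induct)
    case less
    show ?case
    proof (cases "q = c")
      case False
      then obtain y where "y \<in> H" "A q y" "d c y < d c q"
        using D_descent[of c q] c_in_H less.prems by auto
      with less show ?thesis
        by (intro converse_rtrancl_into_rtrancl[of "(\<not> b, q)" "(\<not> b, y)"])
          (auto simp: x verts2_def)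
    qed simp
  qed
  have rung: "((b, q), (\<not> b, c)) \<in> ?E\<^sup>*" if "q \<in> H" "q \<in> R" "q \<noteq> p" for q
    using that intact[of q]
    by (intro converse_rtrancl_into_rtrancl[of "(b, q)" "(\<not> b, q)"]) (auto simp: x verts2_def)
  show ?thesis
  proof (rule G'.connected_nat_graphI)
    show "(\<not> b, c) \<in> verts2 - {x}" using c_in_H by (auto simp: x verts2_def)
  next
    fix v assume v: "v \<in> verts2 - {x}"
    obtain t q where tq: "v = (t, q)" by (cases v)
    show "(v, (\<not> b, c)) \<in> ?E\<^sup>*"
    proof (cases "t = b \<and> q \<notin> R")
      case True
      \<comment> \<open>A vertex without a rung first moves to a neighbour that survives the
        deletion and has a rung.\<close>
      then obtain y where "y \<in> H" "y \<noteq> p" "y \<in> R" "A q y"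
        using neighbour_ne[of q p] v by (auto simp: tq verts2_def)
      then show ?thesis
        using rung[of y] v True
        by (intro converse_rtrancl_into_rtrancl[of v "(b, y)"]) (auto simp: tq x verts2_def)
    next
      case False
      then show ?thesis
        using v rung[of q] intact[of q] by (cases "t = b") (auto simp: tq x verts2_def)
    qed
  qed
qed

lemma cubic_graph2: "cubic (with_proj graph2)"
  unfolding cubic_def
proof
  fix v assume "v \<in> verts (with_proj graph2)"
  then obtain s :: bool and p where v: "v = to_nat (s, p)" and p: "p \<in> H"
    unfolding with_proj_simps pverts_nat_graph verts2_def by auto
  let ?N = "Pair s ` {q \<in> H. A p q}"
  have N: "finite ?N" "card ?N = (if p \<in> R then 2 else 3)"
    using finite_V degree[OF p] by (auto simp: card_image inj_on_def)
  have "{y \<in> verts2. adj2 (s, p) y} = (if p \<in> R then insert (\<not> s, p) ?N else ?N)"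
    using p by (auto simp: verts2_def split: if_splits)
  moreover have "(\<not> s, p) \<notin> ?N" by auto
  ultimately have "card {y \<in> verts2. adj2 (s, p) y} = 3"
    using N by auto
  then show "out_degree (with_proj graph2) v = 3"
    using p by (simp add: v out_degree_nat_graph verts2_def)
qed

lemma card_verts2: "card verts2 = 2 * card H"
  by (simp add: verts2_def card_cartesian_product)

lemma two_connected_graph2: "two_connected (with_proj graph2)"
proof -
  interpret G: rel_distance verts2 adj2 dist2 by (rule rel_distance_dist2)
  have "3 \<le> card H"
    using degree[OF c_in_H] c_notin_R card_mono[of H "{q \<in> H. A c q}"] finite_V by auto
  then have "card (pverts graph2) > 2"
    by (simp only: card_pverts_nat_graph card_verts2)
  moreover have "verts2 \<noteq> {}" using c_in_H by (auto simp: verts2_def)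
  ultimately show ?thesis
    unfolding two_connected_def
    by (auto simp: G.connected_nat_graph del_vert_nat_graph connected_del_vert)
qed

text \<open>The right-hand side is the sum of the distances from \<open>(b, c)\<close>. The
  left-hand side counts ordered pairs, each gaining 2, so the total gain is twice that sum, as
  \<open>soltes_vertex_nat_graphI\<close> requires.\<close>

lemma soltes_vertex_centre:
  assumes "card {(p, q). p \<in> H - {c} \<and> q \<in> H - {c} \<and> arm p \<noteq> arm q} =
    2 * (\<Sum>p\<in>H - {c}. d c p) + card H + 2"
  shows "soltes_vertex (with_proj graph2) (to_nat (b :: bool, c))"
proof -
  let ?K = "H - {c}" and ?V = "verts2 - {(b, c)}"
  have V: "?V = Pair b ` ?K \<union> Pair (\<not> b) ` H"
    by (auto simp: verts2_def)
  have fin: "finite ?K" "finite H" "finite ?V" using finite_V by (auto simp: verts2_def)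
  have sum_V: "(\<Sum>y\<in>?V. f y) = (\<Sum>q\<in>?K. f (b, q)) + (\<Sum>q\<in>H. f (\<not> b, q))"
    for f :: "bool \<times> 'a \<Rightarrow> nat"
  proof -
    have "(\<Sum>y\<in>?V. f y) = sum f (Pair b ` ?K) + sum f (Pair (\<not> b) ` H)"
      unfolding V using fin by (intro sum.union_disjoint) auto
    also have "sum f (Pair b ` ?K) = (\<Sum>q\<in>?K. f (b, q))"
      by (subst sum.reindex) (auto simp: inj_on_def)
    also have "sum f (Pair (\<not> b) ` H) = (\<Sum>q\<in>H. f (\<not> b, q))"
      by (subst sum.reindex) (auto simp: inj_on_def)
    finally show ?thesis .
  qed
  have cH: "card H = card ?K + 1" using card.remove[OF fin(2) c_in_H] by simp
  \<comment> \<open>The twin of \<open>c\<close> has no rung at it and contributes the exceptional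
    3.\<close>
  have "(\<Sum>q\<in>H. dist2 (b, c) (\<not> b, q)) = 3 + (\<Sum>q\<in>?K. d c q + 1)"
    unfolding sum.remove[OF fin(2) c_in_H] using c_notin_R
    by (intro arg_cong2[of _ _ _ _ "(+)"] sum.cong) auto
  then have trans: "(\<Sum>y\<in>?V. dist2 (b, c) y) = 2 * (\<Sum>p\<in>?K. d c p) + card H + 2"
    unfolding sum_V cH by (simp add: sum_Suc)
  have "(\<Sum>x\<in>?V. \<Sum>y\<in>?V. detour b x y) =
      (\<Sum>p\<in>?K. \<Sum>q\<in>?K. if arm p \<noteq> arm q then 2 else 0)"
    unfolding sum_V by simp
  also have "\<dots> = (\<Sum>x\<in>?K \<times> ?K. if arm (fst x) \<noteq> arm (snd x) then 2 else 0)"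
    by (simp add: sum.cartesian_product case_prod_beta)
  also have "\<dots> = 2 * card {(p, q). p \<in> ?K \<and> q \<in> ?K \<and> arm p \<noteq> arm q}"
    using fin by (subst sum.inter_filter[symmetric])
      (auto intro!: arg_cong[of _ _ card])
  finally have detours: "(\<Sum>x\<in>?V. \<Sum>y\<in>?V. detour b x y) =
      2 * card {(p, q). p \<in> ?K \<and> q \<in> ?K \<and> arm p \<noteq> arm q}" .
  show ?thesis
  proof (rule soltes_vertex_nat_graphI[OF rel_distance_dist2 rel_distance_del_centre])
    show "(b, c) \<in> verts2" using c_in_H by (simp add: verts2_def)
    show "verts2 \<noteq> {(b, c)}" using c_in_H by (auto simp: verts2_def)
    show "(\<Sum>x\<in>?V. \<Sum>y\<in>?V. dist2 x y + detour b x y) =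
      (\<Sum>x\<in>?V. \<Sum>y\<in>?V. dist2 x y) + 2 * (\<Sum>y\<in>?V. dist2 (b, c) y)"
      unfolding sum.distrib detours trans assms by simp
  qed
qed

end

section \<open>Spiders\<close>

text \<open>The pair \<open>(k, i)\<close> is the \<open>i\<close>-th vertex of leg
  \<open>k\<close>. The centre formally shares the label 0 with a leg; this is harmless for
  \<open>arm = fst\<close>, as the conditions on \<open>arm\<close> exclude the centre.\<close>

definition spider :: "(nat \<Rightarrow> nat) \<Rightarrow> (nat \<times> nat) set" where
  "spider N = insert (0, 0) (SIGMA k:{..<3}. {1..N k})"

text \<open>The first disjunct leaves \<open>k\<close> and \<open>l\<close> unrelated so that the
  centre meets every leg; the last is the chord closing the triangle at the end of a leg.\<close>

fun spider_arc :: "(nat \<Rightarrow> nat) \<Rightarrow> nat \<times> nat \<Rightarrow> nat \<times> nat \<Rightarrow> bool" where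
  "spider_arc N (k, i) (l, j) \<longleftrightarrow>
    i = 0 \<and> j = 1 \<or> k = l \<and> 1 \<le> i \<and> j = i + 1 \<or> k = l \<and> 1 \<le> i \<and> j = i + 2 \<and> j = N k"

definition spider_adj :: "(nat \<Rightarrow> nat) \<Rightarrow> nat \<times> nat \<Rightarrow> nat \<times> nat \<Rightarrow> bool" where
  "spider_adj N p q \<longleftrightarrow> spider_arc N p q \<or> spider_arc N q p"

text \<open>Excluded are the vertices of degree 3: the centre and, on each leg, the triangle vertex
  nearest to it.\<close>

definition spider_rungs :: "(nat \<Rightarrow> nat) \<Rightarrow> (nat \<times> nat) set" where
  "spider_rungs N = {(k, i). i \<noteq> 0 \<and> i + 2 \<noteq> N k}"

text \<open>The index 0 stands for the centre.  Because of the triangle, both of the last two vertices of a leg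
  are at distance \<open>n - 1\<close> from the centre.\<close>

definition leg_dist :: "nat \<Rightarrow> nat \<Rightarrow> nat \<Rightarrow> nat" where
  "leg_dist n i j =
    (if i \<noteq> j \<and> min i (n - 1) = min j (n - 1) then 1
     else (min i (n - 1) - min j (n - 1)) + (min j (n - 1) - min i (n - 1)))"

fun spider_dist :: "(nat \<Rightarrow> nat) \<Rightarrow> nat \<times> nat \<Rightarrow> nat \<times> nat \<Rightarrow> nat" where
  "spider_dist N (k, i) (l, j) =
    (if k = l then leg_dist (N k) i j else min i (N k - 1) + min j (N l - 1))"

section \<open>Distances along a leg and in the spider\<close>

lemma leg_dist_refl [simp]: "leg_dist n i i = 0"
  by (simp add: leg_dist_def)

lemma leg_dist_sym: "leg_dist n i j = leg_dist n j i"
  by (simp add: leg_dist_def)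

lemma leg_dist_zero: "2 \<le> n \<Longrightarrow> leg_dist n 0 j = min j (n - 1)" "2 \<le> n \<Longrightarrow> leg_dist n i 0 = min i (n - 1)"
  by (auto simp: leg_dist_def)

lemma leg_dist_Suc: "leg_dist n i (Suc j) \<le> Suc (leg_dist n i j)" "leg_dist n i j \<le> Suc (leg_dist n i (Suc j))"
  by (auto simp: leg_dist_def min_def)

lemma leg_dist_chord:
  assumes "n = Suc (Suc j)"
  shows "leg_dist n i n \<le> Suc (leg_dist n i j)" "leg_dist n i j \<le> Suc (leg_dist n i n)"
  using assms by (auto simp: leg_dist_def min_def)

text \<open>Stepping to the adjacent index fails only at the triangle: positions
  \<open>n - 1\<close> and \<open>n\<close> are equally deep, so the chord is taken from
  \<open>n\<close> unless the goal is \<open>n - 1\<close>, and from \<open>n - 2\<close> if the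
  goal is \<open>n\<close>. Keeping \<open>1 \<le> y\<close> makes the path avoid the
  centre.\<close>

lemma leg_dist_descent:
  assumes "1 \<le> i" "i \<le> n" "1 \<le> j" "j \<le> n" "i \<noteq> j"
  obtains y where "1 \<le> y" "y \<le> n" "leg_dist n i y < leg_dist n i j"
    "j = y + 1 \<or> y = j + 1 \<or> j = y + 2 \<and> j = n \<or> y = j + 2 \<and> y = n"
proof -
  consider "i < j" "j < n \<or> i + 1 = n" | "i < j" "j = n" "i + 1 \<noteq> n"
    | "j < i" "i = n" "j + 2 = n" | "j < i" "i \<noteq> n \<or> j + 2 \<noteq> n"
    using assms by linarith
  then show ?thesis
  proof cases
    case 1
    then have "leg_dist n i (j - 1) < leg_dist n i j"
      using assms(2,4) by (auto simp: leg_dist_def min_def)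
    then show ?thesis
      using 1 assms by (intro that[of "j - 1"]) simp_all
  next
    case 2
    then have "leg_dist n i (j - 2) < leg_dist n i j"
      by (auto simp: leg_dist_def min_def)
    moreover have "j = j - 2 + 2" using 2 assms(1) by linarith
    ultimately show ?thesis
      using 2 assms by (intro that[of "j - 2"]) simp_all
  next
    case 3
    then have "leg_dist n i i < leg_dist n i j"
      by (auto simp: leg_dist_def min_def)
    then show ?thesis
      using 3 assms by (intro that[of i]) simp_all
  next
    case 4
    then have "leg_dist n i (j + 1) < leg_dist n i j"
      using assms(2) by (auto simp: leg_dist_def min_def)
    then show ?thesis
      using 4 assms by (intro that[of "j + 1"]) simp_all
  qed
qed

lemma spider_descent_leg:
  assumes "k < 3" "1 \<le> i" "i \<le> N k" "1 \<le> j" "j \<le> N k" "i \<noteq> j"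
  shows "\<exists>y\<in>spider N - {(0, 0)}. spider_adj N (k, j) y \<and> spider_dist N (k, i) y < spider_dist N (k, i) (k, j)"
proof -
  obtain y where y: "1 \<le> y" "y \<le> N k" "leg_dist (N k) i y < leg_dist (N k) i j"
    "j = y + 1 \<or> y = j + 1 \<or> j = y + 2 \<and> j = N k \<or> y = j + 2 \<and> y = N k"
    using leg_dist_descent assms(2-6) .
  then have "(k, y) \<in> spider N - {(0, 0)}" "spider_adj N (k, j) (k, y)"
    using assms by (auto simp: spider_def spider_adj_def)
  then show ?thesis using y by (intro bexI[of _ "(k, y)"]) auto
qed

lemma spider_descent:
  assumes N: "\<forall>k. 4 \<le> N k" and p: "p \<in> spider N" and q: "q \<in> spider N" and ne: "q \<noteq> p"
  shows "\<exists>y\<in>spider N. spider_adj N q y \<and> spider_dist N p y < spider_dist N p q"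
proof -
  obtain k i l j where eqs: "p = (k, i)" "q = (l, j)" by (metis prod.exhaust)
  have N': "2 \<le> N k" for k using N[rule_format, of k] by simp
  consider "1 \<le> i" "1 \<le> j" "k = l" | "j = 0" | "j = 1" "k \<noteq> l \<or> i = 0"
    | "j = N l" "k \<noteq> l \<or> i = 0" | "2 \<le> j" "j < N l" "k \<noteq> l \<or> i = 0"
    using q by (fastforce simp: eqs spider_def)
  then show ?thesis
  proof cases
    case 1
    then show ?thesis
      using spider_descent_leg[where N = N and k = k and i = i and j = j] p q ne
      by (auto simp: eqs spider_def)
  next
    case 2
    with p q ne have "1 \<le> i" "l = 0" "k < 3" "i \<le> N k" by (auto simp: eqs spider_def)
    moreover have "leg_dist (N k) i 1 < min i (N k - 1)"
      using N[rule_format, of k] \<open>1 \<le> i\<close> by (auto simp: leg_dist_def min_def)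
    ultimately show ?thesis
      using 2 N[rule_format, of k]
      by (intro bexI[of _ "(k, 1)"]) (auto simp: eqs spider_def spider_adj_def leg_dist_zero[OF N'])
  next
    case 3
    then show ?thesis
      using N[rule_format, of k] N[rule_format, of l] p q ne
      by (intro bexI[of _ "(0, 0)"])
        (auto simp: eqs spider_def spider_adj_def leg_dist_zero[OF N'] min_def)
  next
    case 4
    \<comment> \<open>Position \<open>N l - 1\<close> is no closer to the centre, so the step
      inwards uses the chord.\<close>
    then show ?thesis
      using N[rule_format, of l] p q ne
      by (intro bexI[of _ "(l, j - 2)"])
        (auto simp: eqs spider_def spider_adj_def leg_dist_zero[OF N'] min_def)
  next
    case 5
    then show ?thesis
      using p q ne
      by (intro bexI[of _ "(l, j - 1)"])
        (auto simp: eqs spider_def spider_adj_def leg_dist_zero[OF N'] min_def)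
  qed
qed

lemma spider_step:
  assumes N: "\<forall>k. 4 \<le> N k" and "p \<in> spider N" "q \<in> spider N" "q' \<in> spider N" "spider_adj N q q'"
  shows "spider_dist N p q' \<le> spider_dist N p q + 1"
proof -
  have N': "2 \<le> N k" for k using N[rule_format, of k] by simp
  have arc: "spider_dist N p r' \<le> spider_dist N p r + 1 \<and> spider_dist N p r \<le> spider_dist N p r' + 1"
    if r: "r \<in> spider N" "r' \<in> spider N" "spider_arc N r r'" for r r'
  proof -
    obtain k i l j l' j' where eqs: "p = (k, i)" "r = (l, j)" "r' = (l', j')" by (metis prod.exhaust)
    consider "j = 0" "j' = 1" | "l = l'" "1 \<le> j" "j' = j + 1"
      | "l = l'" "1 \<le> j" "j' = j + 2" "j' = N l"
      using r(3)[unfolded eqs spider_arc.simps] by blast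
    then show ?thesis
    proof cases
      case 1
      have "leg_dist (N k) i 1 \<le> min i (N k - 1) + 1" "min i (N k - 1) \<le> leg_dist (N k) i 1 + 1"
        using N[rule_format, of k] by (auto simp: leg_dist_def min_def)
      then show ?thesis
        using 1 r(1) N[rule_format, of l'] by (auto simp: eqs spider_def leg_dist_zero[OF N'])
    next
      case 2
      then show ?thesis by (auto simp: eqs leg_dist_Suc)
    next
      case 3
      then have "N l = Suc (Suc j)" by simp
      then show ?thesis
        using 3 leg_dist_chord[of "N l" j i] by (auto simp: eqs)
    qed
  qed
  show ?thesis
    using arc[of q q'] arc[of q' q] assms(3-5) unfolding spider_adj_def by blast
qed

lemma spider_degree:
  assumes N: "\<forall>k. 4 \<le> N k" and p: "p \<in> spider N"
  shows "card {q \<in> spider N. spider_adj N p q} = (if p \<in> spider_rungs N then 2 else 3)"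
proof -
  obtain k i where eqs: "p = (k, i)" by (cases p)
  note defs = eqs spider_def spider_adj_def spider_rungs_def
  consider "p = (0, 0)" | "k < 3" "i = 1" | "k < 3" "i = N k - 2" | "k < 3" "i = N k"
    | "k < 3" "2 \<le> i" "i \<le> N k - 1" "i \<noteq> N k - 2"
    using p by (fastforce simp: defs)
  then show ?thesis
  proof cases
    case 1
    then have "{q \<in> spider N. spider_adj N p q} = {(0, 1), (1, 1), (2, 1)}"
      using N[rule_format, of 0] N[rule_format, of 1] N[rule_format, of 2] by (auto simp: defs)
    then show ?thesis using 1 by (simp add: spider_rungs_def)
  next
    case 2
    then have "{q \<in> spider N. spider_adj N p q} = {(0, 0), (k, 2)}"
      using N[rule_format, of k] by (auto simp: defs)
    then show ?thesis using 2 N[rule_format, of k] by (simp add: eqs spider_rungs_def)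
  next
    case 3
    then have i: "N k = i + 2" "2 \<le> i" using N[rule_format, of k] by auto
    then have "{q \<in> spider N. spider_adj N p q} = {(k, i - 1), (k, i + 1), (k, i + 2)}"
      using 3(1) by (auto simp: defs)
    then show ?thesis using i by (auto simp: eqs spider_rungs_def card_insert_if)
  next
    case 4
    then have "{q \<in> spider N. spider_adj N p q} = {(k, i - 1), (k, i - 2)}"
      using N[rule_format, of k] by (auto simp: defs)
    then show ?thesis using 4 N[rule_format, of k] by (simp add: eqs spider_rungs_def)
  next
    case 5
    then have "{q \<in> spider N. spider_adj N p q} = {(k, i - 1), (k, i + 1)}"
      using N[rule_format, of k] by (auto simp: defs)
    then show ?thesis using 5 N[rule_format, of k] by (simp add: eqs spider_rungs_def)
  qed
qed

lemma rung_double_spider: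
  assumes N: "\<forall>k. 4 \<le> N k"
  shows "rung_double (spider N) (spider_adj N) (spider_dist N) (spider_rungs N) (0, 0) fst"
proof
  show "finite (spider N)" by (simp add: spider_def)
  show "spider_adj N q p" if "spider_adj N p q" for p q
    using that by (auto simp: spider_adj_def)
  show "\<not> spider_adj N p p" for p by (cases p) (auto simp: spider_adj_def)
  show "spider_dist N p p = 0" for p by (cases p) simp
  show "spider_dist N p q = spider_dist N q p" for p q
    by (cases p; cases q) (auto simp: leg_dist_sym)
  show "spider_dist N p q' \<le> spider_dist N p q + 1"
    if "p \<in> spider N" "q \<in> spider N" "q' \<in> spider N" "spider_adj N q q'" for p q q'
    using spider_step[OF N] that by blast
  show "\<exists>y\<in>spider N. spider_adj N q y \<and> spider_dist N p y < spider_dist N p q"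
    if "p \<in> spider N" "q \<in> spider N" "q \<noteq> p" for p q
    using spider_descent[OF N] that by blast
  show "(0, 0) \<in> spider N" "(0, 0) \<notin> spider_rungs N"
    by (simp_all add: spider_def spider_rungs_def)
  \<comment> \<open>Legs of length at least 4 keep the triangle vertex of degree 3 from being
    adjacent to the centre.\<close>
  show "p \<in> spider_rungs N \<or> q \<in> spider_rungs N" if "spider_adj N p q" for p q
    using that N[rule_format, of "fst p"] N[rule_format, of "fst q"]
    by (cases p; cases q) (auto simp: spider_adj_def spider_rungs_def)
  show "card {q \<in> spider N. spider_adj N p q} = (if p \<in> spider_rungs N then 2 else 3)"
    if "p \<in> spider N" for p
    using spider_degree[OF N that] .
  show "fst p = fst q" if "p \<in> spider N - {(0, 0)}" "q \<in> spider N - {(0, 0)}" "spider_adj N p q" for p q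
    using that by (cases p; cases q) (auto simp: spider_def spider_adj_def)
  show "\<exists>y\<in>spider N - {(0, 0)}. spider_adj N q y \<and> spider_dist N p y < spider_dist N p q"
    if "p \<in> spider N - {(0, 0)}" "q \<in> spider N - {(0, 0)}" "fst p = fst q" "p \<noteq> q" for p q
    using that spider_descent_leg[where N = N and k = "fst p" and i = "snd p" and j = "snd q"]
    by (cases p; cases q) (auto simp: spider_def)
qed

section \<open>Counting vertices, distances and pairs in the spider\<close>

lemma spider_minus_centre: "spider N - {(0, 0)} = (SIGMA k:{..<3}. {1..N k})"
  by (auto simp: spider_def)

lemma sum_lessThan_3: "(\<Sum>k<3. f k) = f 0 + f 1 + f (2 :: nat)"
proof -
  have "{..<3} = {0, 1, 2 :: nat}" by auto
  then show ?thesis by (simp add: add.assoc)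
qed

lemma card_spider: "card (spider N) = N 0 + N 1 + N 2 + 1"
proof -
  have "card (spider N - {(0, 0)}) = N 0 + N 1 + N 2"
    unfolding spider_minus_centre by (simp add: sum_lessThan_3)
  then show ?thesis
    using card.remove[of "spider N" "(0, 0)"] by (simp add: spider_def)
qed

text \<open>On a leg of length \<open>n\<close> the distances from the centre are
  \<open>1, ..., n - 1\<close> and once more \<open>n - 1\<close>; twice their sum is
  \<open>n * (n + 1) - 2\<close>. The three subtracted 2s appear as \<open>+ 6\<close> on the
  left.\<close>

lemma sum_spider_dist:
  assumes N: "\<forall>k. 4 \<le> N k"
  shows "2 * (\<Sum>p\<in>spider N - {(0, 0)}. spider_dist N (0, 0) p) + 6 =
    N 0 * (N 0 + 1) + N 1 * (N 1 + 1) + N 2 * (N 2 + 1)"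
proof -
  have N': "2 \<le> N k" for k using N[rule_format, of k] by simp
  have leg: "2 * (\<Sum>i=1..N k. min i (N k - 1)) + 2 = N k * (N k + 1)" for k
  proof -
    obtain m where m: "N k = Suc m" using N[rule_format, of k] by (cases "N k") auto
    have "(\<Sum>i=1..N k. min i (N k - 1)) = (\<Sum>i=1..m. i) + m"
      by (simp add: m)
    moreover have "2 * (\<Sum>i=1..m. i) = m * (m + 1)"
      using gauss_sum_from_Suc_0[of m, where 'a = nat] by (simp)
    ultimately show ?thesis by (simp add: m)
  qed
  have "(\<Sum>p\<in>spider N - {(0, 0)}. spider_dist N (0, 0) p) =
      (\<Sum>p\<in>(SIGMA k:{..<3}. {1..N k}). min (snd p) (N (fst p) - 1))"
    unfolding spider_minus_centre using N by (intro sum.cong refl) (auto simp: leg_dist_zero[OF N'])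
  also have "\<dots> = (\<Sum>k<3. \<Sum>i=1..N k. min i (N k - 1))"
    by (simp add: sum.Sigma case_prod_beta)
  finally show ?thesis
    using leg[of 0] leg[of 1] leg[of 2] unfolding sum_lessThan_3 by linarith
qed

lemma card_spider_leg_pairs:
  "card {(p, q). p \<in> spider N - {(0, 0)} \<and> q \<in> spider N - {(0, 0)} \<and> fst p \<noteq> fst q} =
    2 * (N 0 * N 1 + N 0 * N 2 + N 1 * N 2)"
proof -
  let ?K = "SIGMA k:{..<3}. {1..N k}"
  have "{(p, q). p \<in> spider N - {(0, 0)} \<and> q \<in> spider N - {(0, 0)} \<and> fst p \<noteq> fst q} =
      (SIGMA p:?K. SIGMA l:{..<3} - {fst p}. {1..N l})"
    unfolding spider_minus_centre by auto
  also have "card \<dots> = (\<Sum>p\<in>?K. \<Sum>l\<in>{..<3} - {fst p}. N l)"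
    by (subst card_SigmaI) (auto simp: case_prod_beta)
  also have "\<dots> = (\<Sum>k<3. \<Sum>i=1..N k. \<Sum>l\<in>{..<3} - {k}. N l)"
    by (subst sum.Sigma) (auto simp: case_prod_beta)
  also have "\<dots> = N 0 * (N 1 + N 2) + N 1 * (N 0 + N 2) + N 2 * (N 0 + N 1)"
  proof -
    have "{..<3} - {0} = {1, 2 :: nat}" "{..<3} - {1} = {0, 2 :: nat}" "{..<3} - {2} = {0, 1 :: nat}"
      by auto
    then have "(\<Sum>l\<in>{..<3} - {0}. N l) = N 1 + N 2" "(\<Sum>l\<in>{..<3} - {1}. N l) = N 0 + N 2"
      "(\<Sum>l\<in>{..<3} - {2}. N l) = N 0 + N 1"
      by simp_all
    then show ?thesis
      by (simp add: sum_lessThan_3)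
  qed
  finally show ?thesis by (simp add: algebra_simps)
qed

text \<open>The parameter \<open>s\<close> of the solution is \<open>m + 1\<close>: at
  \<open>s = 0\<close> the second leg would have length 1, below the required 4.\<close>

definition legs :: "nat \<Rightarrow> nat \<Rightarrow> nat" where
  "legs m k = (if k = 0 then 3 * (m + 1)\<^sup>2 + 6 * (m + 1) + 4 else if k = 1 then 3 * (m + 1)\<^sup>2 + 1 else 4)"

lemma legs_ge: "4 \<le> legs m k"
  by (simp add: legs_def power2_eq_square)

lemma legs_balance:
  "card {(p, q). p \<in> spider (legs m) - {(0, 0)} \<and> q \<in> spider (legs m) - {(0, 0)} \<and> fst p \<noteq> fst q} =
    2 * (\<Sum>p\<in>spider (legs m) - {(0, 0)}. spider_dist (legs m) (0, 0) p) + card (spider (legs m)) + 2"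
proof -
  \<comment> \<open>The balance condition with 6 added to both sides, to match
    \<open>sum_spider_dist\<close> and avoid subtraction on \<open>nat\<close>.\<close>
  have "2 * (N 0 * N 1 + N 0 * N 2 + N 1 * N 2) + 6 =
      N 0 * (N 0 + 1) + N 1 * (N 1 + 1) + N 2 * (N 2 + 1) + (N 0 + N 1 + N 2 + 1) + 2"
    if "N = legs m" for N
    unfolding that by (simp add: legs_def power2_eq_square algebra_simps)
  from this[OF refl] show ?thesis
    unfolding card_spider_leg_pairs card_spider
    using sum_spider_dist[of "legs m"] legs_ge by (simp del: One_nat_def)
qed

section \<open>An infinite family separated by the number of vertices\<close>

theorem theorem2p1:
  shows "\<exists>\<G> :: nat pair_pre_digraph set.
    infinite \<G> \<and>
    (\<forall>G \<in> \<G>. pair_graph G \<and> cubic (with_proj G) \<and> two_connected (with_proj G) \<and>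
      card {v \<in> pverts G. soltes_vertex (with_proj G) v} \<ge> 2) \<and>
    pairwise (\<lambda>G H. \<not> digraph_iso (with_proj G) (with_proj H)) \<G>"
proof -
  define F where "F m = rung_double.graph2 (spider (legs m)) (spider_adj (legs m)) (spider_rungs (legs m))" for m
  have double: "rung_double (spider (legs m)) (spider_adj (legs m)) (spider_dist (legs m))
      (spider_rungs (legs m)) (0, 0) fst" for m
    by (rule rung_double_spider) (simp add: legs_ge)
  have good: "pair_graph (F m) \<and> cubic (with_proj (F m)) \<and> two_connected (with_proj (F m)) \<and>
      card {v \<in> pverts (F m). soltes_vertex (with_proj (F m)) v} \<ge> 2" for m
  proof -
    interpret rung_double "spider (legs m)" "spider_adj (legs m)" "spider_dist (legs m)"
      "spider_rungs (legs m)" "(0, 0)" fst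
      by (rule double)
    interpret G: rel_distance verts2 adj2 dist2 by (rule rel_distance_dist2)
    \<comment> \<open>Both copies of the centre qualify, which gives the two vertices.\<close>
    have soltes: "soltes_vertex (with_proj (F m)) (to_nat (b :: bool, (0 :: nat, 0 :: nat)))" for b
      unfolding F_def by (rule soltes_vertex_centre[OF legs_balance])
    let ?S = "{v \<in> pverts (F m). soltes_vertex (with_proj (F m)) v}"
    have "{to_nat (False, (0 :: nat, 0 :: nat)), to_nat (True, (0 :: nat, 0 :: nat))} \<subseteq> ?S"
      using soltes by (auto simp: soltes_vertex_def)
    moreover have "finite ?S"
      using G.finite_V by (simp add: F_def)
    ultimately have "card {to_nat (False, (0 :: nat, 0 :: nat)), to_nat (True, (0 :: nat, 0 :: nat))} \<le> card ?S"
      by (rule card_mono[rotated])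
    then have "2 \<le> card ?S" by simp
    then show ?thesis
      using G.pair_graph_nat_graph cubic_graph2 two_connected_graph2 by (simp add: F_def)
  qed
  have card_F: "card (pverts (F m)) = 2 * (legs m 0 + legs m 1 + legs m 2 + 1)" for m
    unfolding F_def card_pverts_nat_graph rung_double.card_verts2[OF double] card_spider ..
  \<comment> \<open>Isomorphic graphs have equally many vertices, so strict growth yields both the
    infinite range and pairwise non-isomorphism.\<close>
  have mono: "strict_mono (\<lambda>m. card (pverts (F m)))"
    unfolding strict_mono_Suc_iff card_F by (simp add: legs_def power2_eq_square)
  have card_inj: "m = n" if "card (pverts (F m)) = card (pverts (F n))" for m n
    using strict_mono_eq[OF mono] that by simp
  have "inj F" using card_inj by (auto intro: injI)
  then have "infinite (range F)" by (simp add: range_inj_infinite)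
  moreover have "pairwise (\<lambda>G H. \<not> digraph_iso (with_proj G) (with_proj H)) (range F)"
  proof (rule pairwiseI)
    fix G H assume "G \<in> range F" "H \<in> range F" "G \<noteq> H"
    then obtain m n where mn: "G = F m" "H = F n" "m \<noteq> n" by blast
    show "\<not> digraph_iso (with_proj G) (with_proj H)"
    proof
      assume "digraph_iso (with_proj G) (with_proj H)"
      then have "card (pverts (F m)) = card (pverts (F n))"
        using digraph_iso_card_verts[of "with_proj G" "with_proj H"] mn(1,2) by simp
      with card_inj mn(3) show False by blast
    qed
  qed
  ultimately show ?thesis
    using good by (intro exI[of _ "range F"]) auto
qed

end
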